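(* Let $\nu_\infty$ be the infimum of all real constants $\nu>0$ such that there exist number fields $K$ of arbitrarily large degree $n(K)$ (i.e. for every $D$ there is a number field $K$ with $n(K)\ge D$) for which $\|V_\infty(K)\|_\infty\le n(K)^{\nu}$. Then $$0\le\nu_\infty\le\frac{\log(3/2)}{\log 2}=0.5849\ldots$$
   Context: For a number field $K$ of degree $n(K)$, the $L^\infty$ norm on $\mathbb{R}\otimes_{\mathbb{Q}}K$ is $\|x\|_\infty=\max_\sigma|\sigma(x)|$, where $\sigma$ ranges over the $\mathbb{R}$-algebra homomorphisms $\mathbb{R}\otimes_{\mathbb{Q}}K\to\mathbb{C}$ induced by the embeddings $K\to\mathbb{C}$. The $L^\infty$ Voronoi cell is $V_\infty(K)=\{x\in\mathbb{R}\otimes_{\mathbb{Q}}K:\ \|x\|_\infty\le\|x-a\|_\infty\text{ for all }a\in O_K\}$, and $\|V_\infty(K)\|_\infty=\sup_{x\in V_\infty(K)}\|x\|_\infty$. *)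

theory Defs
  imports
    Complex_Main
    "HOL-Library.Extended_Real"
    "HOL-Computational_Algebra.Polynomial"
    "HOL-Algebra.Generated_Groups"
    "HOL-Algebra.Free_Abelian_Groups"
begin

text \<open>
  Number fields are taken to be subfields of the complex numbers that have finite dimension
  over the rationals. Every number field is isomorphic to such a field, and everything
  defined below is invariant under isomorphism.
\<close>

global_interpretation rat_vs: vector_space "\<lambda>(q::rat) (x::complex). of_rat q * x"
  by unfold_locales (simp_all add: of_rat_add of_rat_mult algebra_simps)

definition number_field :: "complex set \<Rightarrow> bool" where
  "number_field K \<longleftrightarrow>
     1 \<in> K \<and> (\<forall>x\<in>K. \<forall>y\<in>K. x - y \<in> K \<and> x * y \<in> K) \<and> (\<forall>x\<in>K. inverse x \<in> K) \<and>
     (\<exists>B. finite B \<and> K = rat_vs.span B)"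

definition nf_degree :: "complex set \<Rightarrow> nat" where
  "nf_degree K = rat_vs.dim K"

definition ring_of_integers :: "complex set \<Rightarrow> complex set" where
  "ring_of_integers K = {a \<in> K. algebraic_int a}"

text \<open>Embeddings are made \<^const>\<open>extensional\<close> so that each is counted only once.\<close>

definition embeddings :: "complex set \<Rightarrow> (complex \<Rightarrow> complex) set" where
  "embeddings K = {\<sigma> \<in> extensional K. \<sigma> 1 = 1 \<and>
     (\<forall>x\<in>K. \<forall>y\<in>K. \<sigma> (x + y) = \<sigma> x + \<sigma> y \<and> \<sigma> (x * y) = \<sigma> x * \<sigma> y)}"

text \<open>
  The tensor product of \<open>\<real>\<close> and \<open>K\<close> over \<open>\<rat>\<close> is the free abelian group on \<open>\<real> \<times> K\<close> modulo the
  subgroup generated by the \<open>\<rat>\<close>-bilinearity relations. Only its additive group and the maps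
  induced by embeddings are needed; group operations are written multiplicatively in
  HOL-Algebra, so the difference of \<open>x\<close> and \<open>y\<close> is \<open>x \<otimes> inv y\<close>.
\<close>

abbreviation formal_sums :: "complex set \<Rightarrow> ((real \<times> complex) \<Rightarrow>\<^sub>0 int) monoid" where
  "formal_sums K \<equiv> free_Abelian_group (UNIV \<times> K)"

definition bilinear_relations :: "complex set \<Rightarrow> ((real \<times> complex) \<Rightarrow>\<^sub>0 int) set" where
  "bilinear_relations K =
     {frag_of (r + s, a) - frag_of (r, a) - frag_of (s, a) | r s a. a \<in> K} \<union>
     {frag_of (r, a + b) - frag_of (r, a) - frag_of (r, b) | r a b. a \<in> K \<and> b \<in> K} \<union>
     {frag_of (r * of_rat q, a) - frag_of (r, of_rat q * a) | r q a. a \<in> K}"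

definition relation_subgroup :: "complex set \<Rightarrow> ((real \<times> complex) \<Rightarrow>\<^sub>0 int) set" where
  "relation_subgroup K = generate (formal_sums K) (bilinear_relations K)"

definition real_tensor :: "complex set \<Rightarrow> ((real \<times> complex) \<Rightarrow>\<^sub>0 int) set monoid" where
  "real_tensor K = formal_sums K Mod relation_subgroup K"

definition pure_tensor ::
    "complex set \<Rightarrow> real \<Rightarrow> complex \<Rightarrow> ((real \<times> complex) \<Rightarrow>\<^sub>0 int) set" where
  "pure_tensor K r a = relation_subgroup K #>\<^bsub>formal_sums K\<^esub> frag_of (r, a)"

text \<open>
  The homomorphism induced by an embedding \<open>\<sigma>\<close> sends \<open>r \<otimes> a\<close> to \<open>r * \<sigma> a\<close>. It is computed on
  representatives; \<open>induced_hom_coset\<close> below shows independence of the representative, so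
  that \<^const>\<open>the_elem\<close> is applied to a singleton.
\<close>

definition eval_formal :: "(complex \<Rightarrow> complex) \<Rightarrow> ((real \<times> complex) \<Rightarrow>\<^sub>0 int) \<Rightarrow> complex" where
  "eval_formal \<sigma> f =
     (\<Sum>(r, a)\<in>Poly_Mapping.keys f. of_int (Poly_Mapping.lookup f (r, a)) * (of_real r * \<sigma> a))"

definition induced_hom ::
    "(complex \<Rightarrow> complex) \<Rightarrow> ((real \<times> complex) \<Rightarrow>\<^sub>0 int) set \<Rightarrow> complex" where
  "induced_hom \<sigma> X = the_elem (eval_formal \<sigma> ` X)"

definition linf_norm :: "complex set \<Rightarrow> ((real \<times> complex) \<Rightarrow>\<^sub>0 int) set \<Rightarrow> real" where
  "linf_norm K X = Max ((\<lambda>\<sigma>. cmod (induced_hom \<sigma> X)) ` embeddings K)"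

definition linf_voronoi_cell :: "complex set \<Rightarrow> ((real \<times> complex) \<Rightarrow>\<^sub>0 int) set set" where
  "linf_voronoi_cell K =
     {X \<in> carrier (real_tensor K). \<forall>a\<in>ring_of_integers K.
        linf_norm K X
          \<le> linf_norm K (X \<otimes>\<^bsub>real_tensor K\<^esub> inv\<^bsub>real_tensor K\<^esub> pure_tensor K 1 a)}"

text \<open>Suprema and infima are taken in \<^typ>\<open>ereal\<close>, where they always exist.\<close>

definition linf_voronoi_radius :: "complex set \<Rightarrow> ereal" where
  "linf_voronoi_radius K = (SUP X\<in>linf_voronoi_cell K. ereal (linf_norm K X))"

definition nu_infinity :: ereal where
  "nu_infinity = Inf {ereal \<nu> | \<nu>. \<nu> > 0 \<and>
     (\<forall>D. \<exists>K. number_field K \<and> nf_degree K \<ge> D \<and>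
            linf_voronoi_radius K \<le> ereal (real (nf_degree K) powr \<nu>))}"


lemma eval_formal_superset:
  assumes "finite A" "Poly_Mapping.keys f \<subseteq> A"
  shows "eval_formal \<sigma> f =
    (\<Sum>p\<in>A. of_int (Poly_Mapping.lookup f p) * (of_real (fst p) * \<sigma> (snd p)))"
  unfolding eval_formal_def case_prod_unfold
  by (rule sum.mono_neutral_cong_left) (use assms in \<open>auto simp: in_keys_iff\<close>)

lemma eval_formal_add: "eval_formal \<sigma> (f + g) = eval_formal \<sigma> f + eval_formal \<sigma> g"
proof -
  let ?A = "Poly_Mapping.keys f \<union> Poly_Mapping.keys g"
  have "Poly_Mapping.keys (f + g) \<subseteq> ?A" by (rule keys_add)
  then show ?thesis
    by (simp add: eval_formal_superset[of ?A] lookup_add sum.distrib algebra_simps)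
qed

lemma eval_formal_uminus: "eval_formal \<sigma> (- f) = - eval_formal \<sigma> f"
  by (simp add: eval_formal_def sum_negf case_prod_unfold)

lemma eval_formal_diff: "eval_formal \<sigma> (f - g) = eval_formal \<sigma> f - eval_formal \<sigma> g"
  using eval_formal_add[of \<sigma> f "- g"] by (simp add: eval_formal_uminus)

lemma eval_formal_frag_of: "eval_formal \<sigma> (frag_of (r, a)) = of_real r * \<sigma> a"
  by (simp add: eval_formal_def)

lemma number_field_closed:
  assumes "number_field K" "a \<in> K"
  shows "0 \<in> K" "- a \<in> K" "b \<in> K \<Longrightarrow> a + b \<in> K" "of_rat q \<in> K" "of_rat q * a \<in> K"
proof -
  obtain B where B: "K = rat_vs.span B"
    using assms(1) by (auto simp: number_field_def)
  show "0 \<in> K" "- a \<in> K" "b \<in> K \<Longrightarrow> a + b \<in> K" "of_rat q * a \<in> K"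
    using assms(2) unfolding B
    by (auto intro: rat_vs.span_zero rat_vs.span_neg rat_vs.span_add rat_vs.span_scale)
  have "1 \<in> rat_vs.span B" using assms(1) B by (simp add: number_field_def)
  from rat_vs.span_scale[OF this, of q] show "of_rat q \<in> K" by (simp add: B)
qed

lemma embedding_of_rat:
  assumes K: "number_field K" and \<sigma>: "\<sigma> \<in> embeddings K"
  shows "\<sigma> (of_rat q) = of_rat q"
proof -
  note cl = number_field_closed[OF K]
  have one: "1 \<in> K" using K by (simp add: number_field_def)
  have rat: "of_rat p \<in> K" for p by (rule cl(4)[OF one])
  have add: "\<sigma> (x + y) = \<sigma> x + \<sigma> y" and mult: "\<sigma> (x * y) = \<sigma> x * \<sigma> y"
    if "x \<in> K" "y \<in> K" for x y
    using \<sigma> that by (auto simp: embeddings_def)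
  have s1: "\<sigma> 1 = 1" using \<sigma> by (simp add: embeddings_def)
  have z: "\<sigma> 0 = 0" using add[OF cl(1)[OF one] cl(1)[OF one]] by simp
  have nat: "\<sigma> (of_nat n) = of_nat n" for n
  proof (induction n)
    case (Suc n)
    have "of_nat n \<in> K" using rat[of "of_nat n"] by simp
    then show ?case using add[OF one, of "of_nat n"] Suc s1 by simp
  qed (simp add: z)
  have int: "\<sigma> (of_int m) = of_int m" for m
  proof (cases m)
    case (neg n)
    have "of_int m \<in> K" "of_nat (Suc n) \<in> K"
      using rat[of "of_int m"] rat[of "of_nat (Suc n)"] by (simp_all only: of_rat_of_int_eq of_rat_of_nat_eq)
    then have "\<sigma> (of_int m + of_nat (Suc n)) = \<sigma> (of_int m) + of_nat (Suc n)"
      using add nat by metis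
    moreover have "of_int m + of_nat (Suc n) = (0::complex)" by (simp add: neg)
    ultimately have "\<sigma> (of_int m) = - of_nat (Suc n)"
      using z by (metis add_eq_0_iff2)
    then show ?thesis by (simp add: neg)
  qed (simp add: nat)
  obtain a b where q: "q = of_int a / of_int b" and b: "b \<noteq> 0"
    by (cases q) (auto simp: Fract_of_int_quotient)
  have "of_int b \<in> K" using rat[of "of_int b"] by simp
  then have "\<sigma> (of_rat q * of_int b) = \<sigma> (of_rat q) * of_int b"
    using mult[OF rat, of "of_int b" q] int by simp
  moreover have "of_rat q * of_int b = (of_int a :: complex)"
    using b by (simp add: q of_rat_divide)
  ultimately show ?thesis using b int
    by (metis mult_right_cancel of_int_eq_0_iff)
qed

lemma bilinear_relations_closed:
  assumes "number_field K"
  shows "bilinear_relations K \<subseteq> carrier (formal_sums K)"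
proof -
  show ?thesis
    unfolding bilinear_relations_def carrier_free_Abelian_group_iff
    using number_field_closed[OF assms]
    by (auto simp: carrier_free_Abelian_group_iff split: if_splits dest!: subsetD[OF keys_diff])
qed

lemma eval_formal_relation:
  assumes K: "number_field K" and \<sigma>: "\<sigma> \<in> embeddings K" and f: "f \<in> relation_subgroup K"
  shows "eval_formal \<sigma> f = 0"
  using f unfolding relation_subgroup_def
proof (induction rule: generate.induct)
  have base: "eval_formal \<sigma> h = 0" if "h \<in> bilinear_relations K" for h
  proof -
    have rat: "\<sigma> (of_rat q * a) = of_rat q * \<sigma> a" if "a \<in> K" for q a
      using \<sigma> that number_field_closed(4)[OF K that, of q] embedding_of_rat[OF K \<sigma>]
      by (simp add: embeddings_def)
    have rc: "complex_of_real (of_rat q) = of_rat q" for q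
      by (cases q) (simp add: of_rat_rat)
    have add: "\<sigma> (a + b) = \<sigma> a + \<sigma> b" if "a \<in> K" "b \<in> K" for a b
      using \<sigma> that by (simp add: embeddings_def)
    show ?thesis
      using that unfolding bilinear_relations_def
      by (auto simp: eval_formal_diff eval_formal_frag_of rat add rc ring_distribs)
  qed
  {
    case one
    show ?case by (simp add: eval_formal_def)
  next
    case (incl h)
    then show ?case by (rule base)
  next
    case (inv h)
    moreover have "h \<in> carrier (formal_sums K)"
      using inv bilinear_relations_closed[OF K] by blast
    ultimately show ?case
      using base by (simp add: eval_formal_uminus)
  next
    case (eng h1 h2)
    then show ?case by (simp add: eval_formal_add)
  }
qed

lemma induced_hom_coset:
  assumes "number_field K" "\<sigma> \<in> embeddings K"
  shows "induced_hom \<sigma> (relation_subgroup K #>\<^bsub>formal_sums K\<^esub> f) = eval_formal \<sigma> f"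
proof -
  have "eval_formal \<sigma> ` (relation_subgroup K #>\<^bsub>formal_sums K\<^esub> f) = {eval_formal \<sigma> f}"
    using eval_formal_relation[OF assms] generate.one[of "formal_sums K" "bilinear_relations K"]
    by (force simp: r_coset_def eval_formal_add relation_subgroup_def)
  then show ?thesis by (simp add: induced_hom_def)
qed

lemma induced_hom_pure:
  assumes "number_field K" "\<sigma> \<in> embeddings K"
  shows "induced_hom \<sigma> (pure_tensor K r a) = of_real r * \<sigma> a"
  by (simp add: pure_tensor_def induced_hom_coset[OF assms] eval_formal_frag_of)

end

theory Submission
  imports Defs "Jordan_Normal_Form.Char_Poly" "HOL-Real_Asymp.Real_Asymp"
begin

text \<open>
  Take \<open>K = \<rat>(\<zeta>)\<close> with \<open>\<zeta> ^ n = - 1\<close> and \<open>n = 2 ^ k\<close>. In the basis of powers of \<open>\<zeta>\<close>, an element of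
  \<open>\<real> \<otimes> K\<close> is a real vector \<open>c\<close>, and its embeddings are the values of \<open>\<Sum>j<n. c j * \<omega> ^ j\<close> at the
  \<open>n\<close> roots of \<open>\<omega> ^ n = - 1\<close>. Randomised rounding of \<open>c\<close> to integers keeps all these values of size
  \<open>O(sqrt n * ln n)\<close> with positive probability. So the exponent is at most \<open>1/2\<close>, which is
  less than \<open>log 2 (3/2)\<close>.
\<close>

subsection \<open>Rounding to integers\<close>

text \<open>For negative \<open>x = - y\<close> the bound is the reciprocal of
  \<open>1 + y <= exp y\<close>, because \<open>(1 + y) * (1 - y + y^2) = 1 + y^3\<close> is at
  least 1.\<close>

lemma exp_le_one_plus_square:
  fixes x :: real
  assumes "\<bar>x\<bar> \<le> 1"
  shows "exp x \<le> 1 + x + x\<^sup>2"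
proof (cases "x \<ge> 0")
  case True
  then show ?thesis using exp_bound assms by auto
next
  case False
  define y where "y = - x"
  have y: "0 < y" "y \<le> 1" using False assms by (auto simp: y_def)
  have "1 \<le> (1 + y) * (1 - y + y\<^sup>2)"
    using y by (simp add: algebra_simps power2_eq_square)
  also have "\<dots> \<le> exp y * (1 - y + y\<^sup>2)"
    using y by (intro mult_right_mono exp_ge_add_one_self) (auto intro: add_nonneg_nonneg)
  finally have "exp (- y) \<le> 1 - y + y\<^sup>2"
    by (simp add: exp_minus field_simps)
  then show ?thesis by (simp add: y_def)
qed

text \<open>The rounding error takes the value \<open>p\<close> with probability
  \<open>1 - p\<close> and \<open>p - 1\<close> with probability \<open>p\<close>. Its mean is zero,
  so the linear terms cancel and only the quadratic one remains.\<close>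

lemma exp_two_point_mean_le:
  fixes p s w :: real
  assumes p: "0 \<le> p" "p \<le> 1" and w: "\<bar>w\<bar> \<le> s" and s: "s \<le> 1"
  shows "(1 - p) * exp (w * p) + p * exp (w * (p - 1)) \<le> exp (s\<^sup>2)"
proof -
  have b: "exp (w * t) \<le> 1 + w * t + s\<^sup>2" if "\<bar>t\<bar> \<le> 1" for t
  proof -
    have wt: "\<bar>w * t\<bar> \<le> s"
      using mult_mono[OF w that] w by (auto simp: abs_mult)
    then have "(w * t)\<^sup>2 \<le> s\<^sup>2" by (metis abs_ge_zero power2_abs power_mono)
    moreover have "exp (w * t) \<le> 1 + w * t + (w * t)\<^sup>2"
      using wt s by (intro exp_le_one_plus_square) auto
    ultimately show ?thesis by linarith
  qed
  have "(1 - p) * exp (w * p) + p * exp (w * (p - 1))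
      \<le> (1 - p) * (1 + w * p + s\<^sup>2) + p * (1 + w * (p - 1) + s\<^sup>2)"
    using p by (intro add_mono mult_left_mono b) auto
  also have "\<dots> = 1 + s\<^sup>2" by (simp add: algebra_simps)
  also have "\<dots> \<le> exp (s\<^sup>2)" by (rule exp_ge_add_one_self)
  finally show ?thesis .
qed

text \<open>
  The right-hand side bounds the mean of the left-hand side when each \<open>c j\<close> is rounded up with
  probability \<open>frac (c j)\<close>; the \<open>u j\<close> are fixed one at a time without exceeding that mean.
\<close>

lemma integer_rounding_exp_potential:
  fixes w :: "'i \<Rightarrow> nat \<Rightarrow> real" and c :: "nat \<Rightarrow> real" and A :: "'i set"
  assumes w: "\<And>i j. i \<in> A \<Longrightarrow> j < n \<Longrightarrow> \<bar>w i j\<bar> \<le> s" and s: "s \<le> 1"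
  shows "\<exists>u :: nat \<Rightarrow> int. (\<Sum>i\<in>A. exp (\<Sum>j<n. w i j * (c j - of_int (u j))))
           \<le> real (card A) * exp (real n * s\<^sup>2)"
  using w
proof (induction n)
  case 0
  then show ?case by simp
next
  case (Suc n)
  then obtain u :: "nat \<Rightarrow> int" where
    u: "(\<Sum>i\<in>A. exp (\<Sum>j<n. w i j * (c j - of_int (u j)))) \<le> real (card A) * exp (real n * s\<^sup>2)"
    by force
  define W where "W i = exp (\<Sum>j<n. w i j * (c j - of_int (u j)))" for i
  define p where "p = frac (c n)"
  have p: "0 \<le> p" "p < 1" by (auto simp: p_def frac_lt_1)
  define T where "T v = (\<Sum>i\<in>A. W i * exp (w i n * (c n - of_int v)))" for v :: int
  have val: "c n - of_int \<lfloor>c n\<rfloor> = p" "c n - of_int (\<lfloor>c n\<rfloor> + 1) = p - 1"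
    by (auto simp: p_def frac_def)
  have "(1 - p) * T \<lfloor>c n\<rfloor> + p * T (\<lfloor>c n\<rfloor> + 1)
      = (\<Sum>i\<in>A. W i * ((1 - p) * exp (w i n * p) + p * exp (w i n * (p - 1))))"
    unfolding T_def val by (simp add: sum_distrib_left sum.distrib sum_subtractf algebra_simps)
  also have "\<dots> \<le> (\<Sum>i\<in>A. W i * exp (s\<^sup>2))"
    using p s Suc.prems by (intro sum_mono mult_left_mono exp_two_point_mean_le) (auto simp: W_def)
  also have "\<dots> \<le> real (card A) * exp (real n * s\<^sup>2) * exp (s\<^sup>2)"
    unfolding sum_distrib_right[symmetric] W_def by (intro mult_right_mono u) auto
  also have "\<dots> = real (card A) * exp (real (Suc n) * s\<^sup>2)"
    by (simp add: exp_add[symmetric] algebra_simps)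
  finally have mean: "(1 - p) * T \<lfloor>c n\<rfloor> + p * T (\<lfloor>c n\<rfloor> + 1) \<le> real (card A) * exp (real (Suc n) * s\<^sup>2)"
    (is "_ \<le> ?M") .
  have "\<exists>v. T v \<le> ?M"
  proof (rule ccontr)
    assume "\<not> ?thesis"
    then have less: "?M < T v" for v by (meson not_le)
    \<comment> \<open>Strictness comes from this term, since \<open>1 - p > 0\<close>. The other
      weight \<open>p\<close> vanishes when \<open>c n\<close> is an integer.\<close>
    have "(1 - p) * ?M < (1 - p) * T \<lfloor>c n\<rfloor>"
      using p by (intro mult_strict_left_mono less) auto
    moreover have "p * ?M \<le> p * T (\<lfloor>c n\<rfloor> + 1)"
      using p by (intro mult_left_mono less_imp_le[OF less]) auto
    moreover have "(1 - p) * ?M + p * ?M = ?M" by (simp add: left_diff_distrib)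
    ultimately show False using mean by linarith
  qed
  then obtain v where v: "T v \<le> ?M" ..
  have "(\<Sum>i\<in>A. exp (\<Sum>j<Suc n. w i j * (c j - of_int ((u(n := v)) j)))) = T v"
    unfolding T_def W_def by (intro sum.cong) (auto simp: exp_add)
  then show ?case using v by (intro exI[of _ "u(n := v)"]) (simp only:)
qed

text \<open>The four rotations expose both signs of the real and imaginary parts. A modulus bound
  thus becomes four one-sided linear bounds, which an exponential potential can control.\<close>

lemma cmod_le_if_rotated_Re_le:
  assumes "\<And>\<epsilon>. \<epsilon> \<in> {1, -1, \<i>, -\<i>} \<Longrightarrow> Re (\<epsilon> * z) \<le> t"
  shows "cmod z \<le> 2 * t"
proof -
  have "\<bar>Re z\<bar> \<le> t" "\<bar>Im z\<bar> \<le> t"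
    using assms[of 1] assms[of "-1"] assms[of \<i>] assms[of "-\<i>"] by auto
  then show ?thesis using cmod_le[of z] by linarith
qed

text \<open>The potential is summed over all pairs of a point and a rotation, at most
  \<open>4 * N\<close> of them. Each term is at most the whole sum; taking logarithms and dividing
  by the scale \<open>s\<close> gives the bound.\<close>

lemma integer_rounding_on_unit_circle:
  fixes c :: "nat \<Rightarrow> real" and \<Omega> :: "complex set"
  assumes fin: "finite \<Omega>" and card: "card \<Omega> \<le> N" and n: "n > 0"
    and unit: "\<And>\<omega>. \<omega> \<in> \<Omega> \<Longrightarrow> cmod \<omega> = 1"
  shows "\<exists>u :: nat \<Rightarrow> int. \<forall>\<omega>\<in>\<Omega>.
    cmod (\<Sum>j<n. (of_real (c j) - of_int (u j)) * \<omega> ^ j) \<le> 2 * sqrt n * (ln (4 * N) + 1)"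
proof (cases "\<Omega> = {}")
  case False
  then have N: "N > 0" using fin card card_gt_0_iff by force
  define A where "A = \<Omega> \<times> {1, -1, \<i>, -\<i>}"
  \<comment> \<open>With this scale the growth factor \<open>exp (n * s^2)\<close> of the potential
    is just \<open>exp 1\<close>.\<close>
  define s where "s = 1 / sqrt (real n)"
  have s: "0 < s" "s \<le> 1" and sn: "real n * s\<^sup>2 = 1"
    using n by (auto simp: s_def power_divide)
  define w where "w = (\<lambda>(\<omega>, \<epsilon>) j. s * Re (\<epsilon> * \<omega> ^ j))"
  have w: "\<bar>w i j\<bar> \<le> s" if "i \<in> A" for i j
  proof -
    obtain \<omega> \<epsilon> where i: "i = (\<omega>, \<epsilon>)" by (cases i)
    have "cmod (\<epsilon> * \<omega> ^ j) = 1" using that unit by (auto simp: i A_def norm_mult norm_power)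
    then have "\<bar>Re (\<epsilon> * \<omega> ^ j)\<bar> \<le> 1" using abs_Re_le_cmod by metis
    then show ?thesis using s by (simp add: w_def i abs_mult)
  qed
  obtain u :: "nat \<Rightarrow> int" where
    u: "(\<Sum>i\<in>A. exp (\<Sum>j<n. w i j * (c j - of_int (u j)))) \<le> real (card A) * exp (real n * s\<^sup>2)"
    using integer_rounding_exp_potential[where A = A and n = n and w = w and s = s and c = c] w s by blast
  have "card {1, -1, \<i>, -\<i>} \<le> 4" by (intro order_trans[OF card_insert_le_m1] ) auto
  then have cA: "card A \<le> 4 * N"
    unfolding A_def card_cartesian_product using card by (metis mult.commute mult_le_mono)
  have "cmod (\<Sum>j<n. (of_real (c j) - of_int (u j)) * \<omega> ^ j) \<le> 2 * (sqrt n * (ln (4 * N) + 1))"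
    if \<omega>: "\<omega> \<in> \<Omega>" for \<omega>
  proof (rule cmod_le_if_rotated_Re_le)
    fix \<epsilon> :: complex
    assume \<epsilon>: "\<epsilon> \<in> {1, -1, \<i>, -\<i>}"
    let ?z = "\<Sum>j<n. (of_real (c j) - of_int (u j)) * \<omega> ^ j"
    have "s * Re (\<epsilon> * ?z) = (\<Sum>j<n. w (\<omega>, \<epsilon>) j * (c j - of_int (u j)))"
    proof -
      have "\<epsilon> * ?z = (\<Sum>j<n. of_real (c j - of_int (u j)) * (\<epsilon> * \<omega> ^ j))"
        by (simp add: sum_distrib_left mult_ac)
      then show ?thesis
        by (simp add: w_def sum_distrib_left algebra_simps)
    qed
    then have "exp (s * Re (\<epsilon> * ?z)) = exp (\<Sum>j<n. w (\<omega>, \<epsilon>) j * (c j - of_int (u j)))"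
      by simp
    also have "\<dots> \<le> (\<Sum>i\<in>A. exp (\<Sum>j<n. w i j * (c j - of_int (u j))))"
      using fin \<omega> \<epsilon> by (intro member_le_sum) (auto simp: A_def)
    also have "\<dots> \<le> real (4 * N) * exp 1"
      using u cA sn by (smt (verit) exp_gt_zero mult_right_mono of_nat_mono)
    also have "\<dots> = exp (ln (4 * N) + 1)"
      using N by (simp add: exp_add)
    finally have "s * Re (\<epsilon> * ?z) \<le> ln (4 * N) + 1" by simp
    then show "Re (\<epsilon> * ?z) \<le> sqrt n * (ln (4 * N) + 1)"
      using n by (simp add: s_def field_simps)
  qed
  then show ?thesis by (auto simp: mult.assoc)
qed auto

section \<open>Numerical and asymptotic estimates\<close>

lemma log2_three_halves_bounds:
  "0.5849 \<le> ln (3/2) / ln (2::real)" "ln (3/2) / ln (2::real) < 0.5850"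
proof -
  \<comment> \<open>The fractions 84/53 and 485/306 are continued fraction convergents of the base 2
    logarithm of 3, one from each side.\<close>
  have "84 * ln (2::real) = ln (2 ^ 84)" by (subst ln_realpow) auto
  also have "\<dots> \<le> ln (3 ^ 53)" by (subst ln_le_cancel_iff) auto
  also have "\<dots> = 53 * ln (3::real)" by (subst ln_realpow) auto
  finally have l: "84 * ln (2::real) \<le> 53 * ln 3" .
  have "306 * ln (3::real) = ln (3 ^ 306)" by (subst ln_realpow) auto
  also have "\<dots> < ln (2 ^ 485)" by (subst ln_less_cancel_iff) auto
  also have "\<dots> = 485 * ln (2::real)" by (subst ln_realpow) auto
  finally have r: "306 * ln (3::real) < 485 * ln 2" .
  have "ln (2::real) > 0" by simp
  with l r show "0.5849 \<le> ln (3/2) / ln (2::real)" "ln (3/2) / ln (2::real) < 0.5850"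
    by (simp_all add: ln_div field_simps)
qed

text \<open>Any exponent above 1/2 absorbs the logarithm; 58/100 also lies below 0.5849.\<close>

lemma eventually_rounding_bound:
  "eventually (\<lambda>n::nat. 2 * sqrt n * (ln (4 * n) + 1) \<le> n powr (58/100)) at_top"
  by real_asymp

subsection \<open>Cyclotomic fields of two-power conductor\<close>

interpretation of_rat_poly_hom: map_poly_inj_idom_hom of_rat ..

text \<open>The eigenvalue is a root of the characteristic polynomial, which is monic with integer
  coefficients.\<close>

lemma algebraic_int_if_integer_matrix_eigenvalue:
  fixes a :: complex and c :: "nat \<Rightarrow> nat \<Rightarrow> int" and v :: "nat \<Rightarrow> complex"
  assumes eig: "\<And>i. i < n \<Longrightarrow> a * v i = (\<Sum>j<n. of_int (c i j) * v j)"
    and nz: "i < n" "v i \<noteq> 0"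
  shows "algebraic_int a"
proof -
  define M where "M = mat n n (\<lambda>(i, j). c i j)"
  define V where "V = vec n v"
  have M: "M \<in> carrier_mat n n" by (simp add: M_def)
  have M': "map_mat of_int M \<in> carrier_mat n n" using M by simp
  have "map_mat of_int M *\<^sub>v V = a \<cdot>\<^sub>v V"
    by (rule eq_vecI) (auto simp: M_def V_def scalar_prod_def eig lessThan_atLeast0)
  moreover have "V \<noteq> 0\<^sub>v n"
    using nz by (metis V_def index_vec index_zero_vec(1))
  ultimately have "eigenvalue (map_mat of_int M) a"
    using M unfolding eigenvalue_def eigenvector_def by (intro exI[of _ V]) (auto simp: V_def)
  then have "poly (char_poly (map_mat of_int M)) a = 0"
    using eigenvalue_root_char_poly[OF M'] by blast
  then have "poly (map_poly of_int (char_poly M)) a = 0"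
    using of_int_hom.char_poly_hom[OF M] by metis
  moreover have "lead_coeff (char_poly M) = 1"
    using degree_monic_char_poly[OF M] by simp
  ultimately show ?thesis
    unfolding algebraic_int_altdef_ipoly by blast
qed

lemma rat_poly_clear_denominators:
  fixes r :: "rat poly"
  shows "\<exists>d p. d \<noteq> 0 \<and> Polynomial.smult (of_int d) r = map_poly of_int p"
proof (induction r)
  case 0
  then show ?case by (intro exI[of _ 1] exI[of _ 0]) simp
next
  case (pCons a r)
  then obtain d p where d: "d \<noteq> 0" and p: "Polynomial.smult (of_int d) r = map_poly of_int p" by blast
  obtain x y where a: "a = of_int x / of_int y" and y: "y \<noteq> (0::int)"
    by (cases a) (auto simp: Fract_of_int_quotient)
  have "Polynomial.smult (of_int (d * y)) (pCons a r) = pCons (of_int (d * x)) (Polynomial.smult (of_int y) (Polynomial.smult (of_int d) r))"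
    using y by (simp add: a mult.commute)
  also have "\<dots> = map_poly of_int (pCons (d * x) (Polynomial.smult y p))"
    by (simp add: p map_poly_pCons hom_distribs)
  finally show ?case using d y by (intro exI[of _ "d * y"] exI conjI) auto
qed

text \<open>Such a \<open>\<zeta>\<close> is a primitive root of unity of order
  \<open>2 * n\<close>, and \<open>X^n + 1\<close> will turn out to be its minimal
  polynomial.\<close>

locale two_power_cyclotomic =
  fixes k n :: nat and \<zeta> :: complex
  assumes n: "n = 2 ^ k" and zeta: "\<zeta> ^ n = - 1"
begin

lemma n_pos: "n > 0"
  by (simp add: n)

text \<open>Horner's scheme: multiplication by \<open>\<zeta>\<close> shifts the coefficients. The
  homomorphism \<open>h\<close> is left general to cover both integer and rational
  coefficients.\<close>

lemma power_basis_repr: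
  assumes "comm_ring_hom h"
  shows "\<exists>c. poly (map_poly h p) \<zeta> = (\<Sum>j<n. h (c j) * \<zeta> ^ j)"
proof -
  interpret h: comm_ring_hom h by fact
  obtain m where m: "n = Suc m" using n_pos by (cases n) auto
  show ?thesis
  proof (induction p)
    case 0
    then show ?case by (intro exI[of _ "\<lambda>_. 0"]) simp
  next
    case (pCons a p)
    then obtain c where c: "poly (map_poly h p) \<zeta> = (\<Sum>j<n. h (c j) * \<zeta> ^ j)" by blast
    \<comment> \<open>The top coefficient wraps around to degree 0 with a minus sign, because
      \<open>\<zeta> ^ n = - 1\<close>.\<close>
    define c' where "c' j = (case j of 0 \<Rightarrow> a - c m | Suc i \<Rightarrow> c i)" for j
    have "\<zeta> * (\<Sum>j<n. h (c j) * \<zeta> ^ j) = (\<Sum>j<m. h (c j) * \<zeta> ^ Suc j) + h (c m) * \<zeta> ^ n"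
      by (simp add: m sum_distrib_left algebra_simps)
    also have "h a + \<dots> = (\<Sum>j<n. h (c' j) * \<zeta> ^ j)"
      unfolding zeta by (simp add: m sum.lessThan_Suc_shift c'_def h.hom_minus del: sum.lessThan_Suc)
    finally have "poly (map_poly h (pCons a p)) \<zeta> = (\<Sum>j<n. h (c' j) * \<zeta> ^ j)"
      by (simp add: c map_poly_pCons hom_distribs add.assoc)
    then show ?case by blast
  qed
qed

abbreviation evi :: "int poly \<Rightarrow> complex" where
  "evi p \<equiv> poly (map_poly of_int p) \<zeta>"

abbreviation evr :: "rat poly \<Rightarrow> complex" where
  "evr p \<equiv> poly (map_poly of_rat p) \<zeta>"

text \<open>Multiplication by \<open>evi p\<close> acts on the powers of \<open>\<zeta>\<close>
  through an integer matrix; the vector of these powers is an eigenvector with first entry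
  1.\<close>

lemma algebraic_int_evi: "algebraic_int (evi p)"
proof -
  have "\<exists>c. \<forall>i. evi p * \<zeta> ^ i = (\<Sum>j<n. of_int (c i j) * \<zeta> ^ j)"
  proof (rule choice, rule allI)
    fix i
    have "evi p * \<zeta> ^ i = evi (p * monom 1 i)"
      by (simp add: hom_distribs poly_monom)
    then show "\<exists>c. evi p * \<zeta> ^ i = (\<Sum>j<n. of_int (c j) * \<zeta> ^ j)"
      using power_basis_repr[OF of_int_hom.comm_ring_hom_axioms] by metis
  qed
  then show ?thesis
    using algebraic_int_if_integer_matrix_eigenvalue[of n "evi p" "\<lambda>i. \<zeta> ^ i" _ 0] n_pos by auto
qed

section \<open>The element \<open>1 - \<zeta>\<close> and divisibility by 2\<close>

lemma one_minus_X_power_two_power: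
  "\<exists>g :: int poly. [:1, -1:] ^ (2 ^ i) = 1 + monom 1 (2 ^ i) + 2 * g"
proof (induction i)
  case 0
  show ?case by (rule exI[of _ "[:0, -1:]"]) (simp add: monom_altdef one_pCons numeral_poly)
next
  case (Suc i)
  then obtain g :: "int poly" where g: "[:1, -1:] ^ (2 ^ i) = 1 + monom 1 (2 ^ i) + 2 * g" by blast
  let ?X = "monom 1 (2 ^ i) :: int poly"
  have X: "?X * ?X = monom 1 (2 ^ Suc i)" by (simp only: mult_monom power_Suc mult_2 mult_1)
  have "[:1, -1:] ^ (2 ^ Suc i) = (1 + ?X + 2 * g) * (1 + ?X + 2 * g)"
    unfolding g[symmetric] power_add[symmetric] by (simp only: power_Suc mult_2)
  \<comment> \<open>Squaring is additive modulo 2: all cross terms carry a factor 2.\<close>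
  also have "\<dots> = 1 + ?X * ?X + 2 * (?X + 2 * g * (1 + ?X) + 2 * g * g)"
    by (simp add: algebra_simps)
  finally show ?case unfolding X by blast
qed

lemma one_minus_zeta_power_even: "\<exists>g. (1 - \<zeta>) ^ n = 2 * evi g"
proof -
  obtain g :: "int poly" where g: "[:1, -1:] ^ n = 1 + monom 1 n + 2 * g"
    using one_minus_X_power_two_power[of k] unfolding n by blast
  have "(1 - \<zeta>) ^ n = evi ([:1, -1:] ^ n)"
    by (simp add: hom_distribs map_poly_pCons)
  also have "\<dots> = 1 + \<zeta> ^ n + 2 * evi g"
    unfolding g by (simp add: hom_distribs poly_monom)
  finally show ?thesis using zeta by auto
qed

text \<open>Factor \<open>1 - \<zeta>^(2*m) = (1 - \<zeta>^m) * (1 + \<zeta>^m)\<close> repeatedly,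
  with both factors divisible by \<open>(1 - \<zeta>)^m\<close>. At \<open>i = k\<close> the left
  side is \<open>1 - \<zeta>^n = 2\<close>.\<close>

lemma two_eq_one_minus_zeta_power: "\<exists>w. 2 = (1 - \<zeta>) ^ n * evi w"
proof -
  have "\<exists>w. 1 - \<zeta> ^ (2 ^ i) = (1 - \<zeta>) ^ (2 ^ i) * evi w" if "i \<le> k" for i
    using that
  proof (induction i)
    case 0
    show ?case by (rule exI[of _ 1]) simp
  next
    case (Suc i)
    define m :: nat where "m = 2 ^ i"
    obtain w where w: "1 - \<zeta> ^ m = (1 - \<zeta>) ^ m * evi w"
      using Suc by (auto simp: m_def)
    \<comment> \<open>This exponent realises the sign change, so
      \<open>1 + \<zeta>^m = 1 - (\<zeta>^m)^e\<close> and the geometric sum extracts the factor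
      \<open>1 - \<zeta>^m\<close>.\<close>
    define e :: nat where "e = 1 + 2 ^ (k - i)"
    have "m * 2 ^ (k - i) = n"
      using Suc.prems by (simp add: m_def n power_add[symmetric])
    then have "(\<zeta> ^ m) ^ e = - (\<zeta> ^ m)"
      by (simp add: e_def power_add power_mult[symmetric] zeta)
    then have "1 + \<zeta> ^ m = 1 - (\<zeta> ^ m) ^ e" by simp
    also have "\<dots> = (1 - \<zeta> ^ m) * (\<Sum>t<e. (\<zeta> ^ m) ^ t)"
      by (rule one_diff_power_eq)
    also have "(\<Sum>t<e. (\<zeta> ^ m) ^ t) = evi (\<Sum>t<e. monom 1 m ^ t)"
      by (simp add: hom_distribs poly_sum poly_monom)
    finally have "1 + \<zeta> ^ m = (1 - \<zeta>) ^ m * evi (w * (\<Sum>t<e. monom 1 m ^ t))"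
      by (simp add: w hom_distribs mult.assoc)
    moreover have m2: "2 ^ Suc i = m + m" by (simp add: m_def)
    moreover have "1 - \<zeta> ^ (m + m) = (1 - \<zeta> ^ m) * (1 + \<zeta> ^ m)"
      by (simp add: power_add algebra_simps)
    ultimately have "1 - \<zeta> ^ (2 ^ Suc i)
        = (1 - \<zeta>) ^ (2 ^ Suc i) * evi (w * (w * (\<Sum>t<e. monom 1 m ^ t)))"
      unfolding m2 w by (simp add: w hom_distribs power_add mult_ac)
    then show ?case by blast
  qed
  from this[of k] show ?thesis by (auto simp: n[symmetric] zeta)
qed

text \<open>An inverse of \<open>1 - \<zeta>\<close> would, after raising to the power
  \<open>n\<close>, make 1/2 an algebraic integer.\<close>

lemma one_minus_zeta_not_unit: "(1 - \<zeta>) * evi y \<noteq> 1"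
proof
  assume eq: "(1 - \<zeta>) * evi y = 1"
  obtain g where g: "(1 - \<zeta>) ^ n = 2 * evi g" using one_minus_zeta_power_even by blast
  have "1 = (1 - \<zeta>) ^ n * evi y ^ n" using eq by (metis power_mult_distrib power_one)
  also have "\<dots> = 2 * evi (g * y ^ n)" by (simp add: g hom_distribs)
  finally have "evi (g * y ^ n) = 1 / 2" by (metis nonzero_mult_div_cancel_left zero_neq_numeral)
  then have "algebraic_int (1 / 2 :: complex)" using algebraic_int_evi by metis
  then have "(1 / 2 :: complex) \<in> \<int>" by (rule rational_algebraic_int_is_int) auto
  then obtain m where "(1 / 2 :: complex) = of_int m" by (auto elim: Ints_cases)
  then have "(of_int (2 * m) :: complex) = of_int 1" by (simp add: mult.commute)
  then have "2 * m = 1" by (subst (asm) of_int_eq_iff)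
  then show False by presburger
qed

text \<open>
  Written in powers of \<open>\<pi> = 1 - \<zeta>\<close>, a primitive relation has a first odd coefficient; every other
  term is divisible by a higher power of \<open>\<pi>\<close> because \<open>2\<close> is a multiple of \<open>\<pi> ^ n\<close>.
\<close>

lemma evi_nonzero:
  assumes p: "p \<noteq> 0" "degree p < n"
  shows "evi p \<noteq> 0"
proof
  assume ev0: "evi p = 0"
  define \<pi> where "\<pi> = 1 - \<zeta>"
  have pi: "\<pi> = evi [:1, -1:]" by (simp add: \<pi>_def map_poly_pCons hom_distribs)
  obtain w where w: "2 = \<pi> ^ n * evi w"
    using two_eq_one_minus_zeta_power unfolding \<pi>_def by blast
  have pi0: "\<pi> \<noteq> 0" using w n_pos by (auto simp: power_0_left)
  \<comment> \<open>The substitution of \<open>1 - X\<close> for \<open>X\<close> is an involution,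
    so \<open>q\<close> expands \<open>p\<close> in powers of \<open>1 - X\<close> and vanishes at
    \<open>\<pi>\<close>.\<close>
  define q where "q = p \<circ>\<^sub>p [:1, -1:]"
  have "q \<circ>\<^sub>p [:1, -1:] = p"
    unfolding q_def pcompose_assoc[symmetric] by (simp add: pcompose_pCons pcompose_idR)
  then have qpi: "poly (map_poly of_int q) \<pi> = 0"
    using ev0 unfolding pi by (metis of_int_hom.map_poly_pcompose poly_pcompose)
  have q0: "q \<noteq> 0" using p \<open>q \<circ>\<^sub>p [:1, -1:] = p\<close> by auto
  \<comment> \<open>Dividing by the content keeps the root \<open>\<pi>\<close> and ensures an odd
    coefficient.\<close>
  define r where "r = primitive_part q"
  have qr: "q = Polynomial.smult (content q) r" by (simp add: r_def)
  then have rpi: "poly (map_poly of_int r) \<pi> = 0"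
    using qpi q0 by (metis content_eq_zero_iff mult_eq_0_iff of_int_eq_0_iff of_int_hom.map_poly_hom_smult poly_smult)
  have degr: "degree r < n" using p(2) by (simp add: r_def q_def degree_pcompose)
  have "\<exists>j. odd (coeff r j)"
  proof (rule ccontr)
    assume "\<not> ?thesis"
    then have "[:2:] dvd r" by (simp add: const_poly_dvd_iff)
    then have "2 dvd content r" by (simp add: const_poly_dvd_iff_dvd_content)
    then show False using q0 by (simp add: r_def)
  qed
  define j where "j = (LEAST j. odd (coeff r j))"
  have j: "odd (coeff r j)" unfolding j_def by (rule LeastI_ex) fact
  have jn: "j < n" using j degr by (metis coeff_eq_0 even_zero linorder_not_less order_less_le_trans)
  have ev: "even (coeff r i)" if "i < j" for i
    using that not_less_Least unfolding j_def by blast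
  have "\<exists>z. of_int (coeff r i) * \<pi> ^ i = \<pi> ^ Suc j * evi z" if "i \<noteq> j" for i
  proof (cases "i < j")
    case True
    then obtain m where m: "coeff r i = 2 * m" using ev by blast
    obtain d where d: "n = Suc j + d" using jn Suc_leI le_Suc_ex by blast
    have "of_int (coeff r i) * \<pi> ^ i = of_int m * \<pi> ^ i * 2" by (simp add: m)
    also have "\<dots> = \<pi> ^ Suc j * evi ([:m:] * [:1, -1:] ^ i * [:1, -1:] ^ d * w)"
      unfolding w by (simp add: d power_add pi hom_distribs mult.assoc mult.left_commute mult.commute)
    finally show ?thesis by blast
  next
    case False
    with that have "Suc j \<le> i" by simp
    then obtain d where d: "i = Suc j + d" using le_Suc_ex by blast
    have "of_int (coeff r i) * \<pi> ^ i = \<pi> ^ Suc j * evi ([:coeff r i:] * [:1, -1:] ^ d)"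
      by (simp add: d power_add pi hom_distribs mult.assoc mult.left_commute mult.commute)
    then show ?thesis by blast
  qed
  then obtain z where z: "\<And>i. i \<noteq> j \<Longrightarrow> of_int (coeff r i) * \<pi> ^ i = \<pi> ^ Suc j * evi (z i)" by metis
  define y where "y = (\<Sum>i\<in>{..<n} - {j}. z i)"
  have "0 = (\<Sum>i<n. of_int (coeff r i) * \<pi> ^ i)"
    unfolding rpi[symmetric] poly_altdef
    by (rule sum.mono_neutral_cong_left) (use degr in \<open>auto simp: coeff_eq_0\<close>)
  also have "\<dots> = of_int (coeff r j) * \<pi> ^ j + (\<Sum>i\<in>{..<n} - {j}. of_int (coeff r i) * \<pi> ^ i)"
    using jn by (intro sum.remove) auto
  also have "(\<Sum>i\<in>{..<n} - {j}. of_int (coeff r i) * \<pi> ^ i) = \<pi> ^ Suc j * evi y"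
    by (simp add: y_def z hom_distribs poly_sum sum_distrib_left)
  finally have "\<pi> ^ j * (of_int (coeff r j) + \<pi> * evi y) = 0"
    by (simp add: algebra_simps)
  then have cj: "of_int (coeff r j) = - \<pi> * evi y"
    using pi0 by (simp add: eq_neg_iff_add_eq_0)
  obtain m where m: "coeff r j = 2 * m + 1" using j by (elim oddE)
  obtain d where d: "n = Suc d" using n_pos by (cases n) auto
  \<comment> \<open>Both the odd coefficient and 2 are multiples of \<open>\<pi>\<close>, hence so
    is 1.\<close>
  have "(1 :: complex) = of_int (coeff r j) - of_int m * 2" by (simp add: m)
  also have "\<dots> = \<pi> * evi (- y - [:m:] * [:1, -1:] ^ d * w)"
    unfolding cj w by (simp add: d pi hom_distribs algebra_simps)
  finally show False using one_minus_zeta_not_unit unfolding \<pi>_def by metis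
qed

text \<open>Clearing denominators reduces this to integer polynomials. It says that
  \<open>\<zeta>\<close> has degree at least \<open>n\<close> over the rationals.\<close>

lemma evr_nonzero:
  assumes r: "r \<noteq> 0" "degree r < n"
  shows "evr r \<noteq> 0"
proof
  assume ev0: "evr r = 0"
  obtain d p where d: "d \<noteq> 0" and p: "Polynomial.smult (of_int d) r = map_poly of_int p"
    using rat_poly_clear_denominators by blast
  have deg: "degree (map_poly of_int p :: rat poly) = degree p" by simp
  have "p \<noteq> 0" using d r p by auto
  moreover have "degree p < n" using d r p deg by (metis degree_smult_eq of_int_eq_0_iff)
  moreover have "evi p = evr (map_poly of_int p)"
    by (simp add: map_poly_map_poly o_def)
  then have "evi p = 0" unfolding p[symmetric] by (simp add: hom_distribs ev0)
  ultimately show False using evi_nonzero by blast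
qed

text \<open>Euclidean descent: dividing \<open>X^n + 1\<close> by \<open>p\<close> makes
  \<open>evr p\<close> a divisor of the value of the remainder, whose degree is smaller and whose
  inverse is known by induction.\<close>

lemma evr_inverse:
  assumes "p \<noteq> 0" "degree p < n"
  shows "\<exists>q. evr q * evr p = 1"
  using assms
proof (induction "degree p" arbitrary: p rule: less_induct)
  case less
  show ?case
  proof (cases "degree p = 0")
    case True
    then obtain a where a: "p = [:a:]" by (metis degree_eq_zeroE)
    then have "evr [:inverse a:] * evr p = of_rat (inverse a * a)"
      by (simp add: hom_distribs)
    also have "\<dots> = 1" using a less.prems by simp
    finally show ?thesis by blast
  next
    case False
    define F :: "rat poly" where "F = monom 1 n + 1"
    have degF: "degree F = n"
      using n_pos by (simp add: F_def degree_add_eq_left degree_monom_eq)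
    have evF: "evr F = 0" by (simp add: F_def hom_distribs poly_monom zeta)
    define s r where "s = F div p" and "r = F mod p"
    have F: "F = s * p + r" by (simp add: s_def r_def)
    have rdeg: "r = 0 \<or> degree r < degree p" using degree_mod_less[of p F] less.prems by (auto simp: r_def)
    have ev: "evr s * evr p = - evr r"
      using evF unfolding F by (simp add: hom_distribs eq_neg_iff_add_eq_0)
    \<comment> \<open>A zero remainder would factor \<open>X^n + 1\<close> into polynomials of
      degree below \<open>n\<close>, neither of which vanishes at \<open>\<zeta>\<close>.\<close>
    have r0: "r \<noteq> 0"
    proof
      assume r0: "r = 0"
      then have "s \<noteq> 0" using F degF n_pos by auto
      have "degree s + degree p = n"
        using degF less.prems \<open>s \<noteq> 0\<close> r0 by (simp add: F degree_mult_eq)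
      then have "evr s \<noteq> 0" using False \<open>s \<noteq> 0\<close> by (intro evr_nonzero) auto
      moreover have "evr p \<noteq> 0" using less.prems by (intro evr_nonzero)
      ultimately show False using ev r0 by simp
    qed
    obtain q where "evr q * evr r = 1"
      using less.hyps[of r] rdeg r0 less.prems by auto
    then have "evr (- (q * s)) * evr p = 1"
      using ev by (simp add: hom_distribs mult.assoc)
    then show ?thesis by blast
  qed
qed

section \<open>The field generated by \<open>\<zeta>\<close> and its degree\<close>

definition K :: "complex set" where "K = range evr"

lemma zeta_power_in_K: "\<zeta> ^ j \<in> K"
  unfolding K_def by (rule image_eqI[of _ _ "monom 1 j"]) (auto simp: hom_distribs poly_monom)

lemma K_repr:
  assumes "x \<in> K"
  shows "\<exists>c. x = (\<Sum>j<n. of_rat (c j) * \<zeta> ^ j)"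
  using assms power_basis_repr[OF of_rat_hom.comm_ring_hom_axioms] by (auto simp: K_def)

lemma power_sum_eq_evr:
  "(\<Sum>j<n. of_rat (c j) * \<zeta> ^ j) = evr (\<Sum>j<n. monom (c j) j)"
  by (simp add: hom_distribs poly_sum poly_monom)

lemma degree_power_sum: "degree (\<Sum>j<n. monom (c j :: rat) j) < n"
proof -
  have "degree (\<Sum>j<n. monom (c j) j) \<le> n - 1"
    by (intro degree_sum_le) (auto intro: order_trans[OF degree_monom_le])
  then show ?thesis using n_pos by linarith
qed

lemma power_basis_independent:
  assumes "(\<Sum>j<n. of_rat (c j) * \<zeta> ^ j) = 0" "j < n"
  shows "c j = 0"
proof -
  have "(\<Sum>j<n. monom (c j) j) = 0"
    using assms(1) evr_nonzero degree_power_sum unfolding power_sum_eq_evr by blast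
  then have "coeff (\<Sum>j<n. monom (c j) j) j = 0" by simp
  then show ?thesis using assms(2) by (simp add: coeff_sum if_distrib cong: if_cong)
qed

lemma inj_power_basis: "inj_on (\<lambda>j. \<zeta> ^ j) {..<n}"
proof (rule linorder_inj_onI')
  fix i j assume ij: "i \<in> {..<n}" "j \<in> {..<n}" "i < j"
  have "evr (monom 1 i - monom 1 j) \<noteq> 0"
  proof (rule evr_nonzero)
    show "monom 1 i - monom 1 j \<noteq> (0 :: rat poly)"
      using ij by (simp add: monom_eq_iff')
    show "degree (monom 1 i - monom 1 j :: rat poly) < n"
      using ij by (intro degree_diff_less) (auto simp: degree_monom_eq)
  qed
  then show "\<zeta> ^ i \<noteq> \<zeta> ^ j" by (simp add: hom_distribs poly_monom)
qed

lemma K_eq_span: "K = rat_vs.span ((\<lambda>j. \<zeta> ^ j) ` {..<n})"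
proof
  show "K \<subseteq> rat_vs.span ((\<lambda>j. \<zeta> ^ j) ` {..<n})"
  proof
    fix x assume "x \<in> K"
    then obtain c where x: "x = (\<Sum>j<n. of_rat (c j) * \<zeta> ^ j)" using K_repr by blast
    show "x \<in> rat_vs.span ((\<lambda>j. \<zeta> ^ j) ` {..<n})"
      unfolding x by (intro rat_vs.span_sum rat_vs.span_scale rat_vs.span_base) auto
  qed
  have "rat_vs.subspace K"
    unfolding rat_vs.subspace_def
  proof (intro conjI ballI allI)
    show "0 \<in> K" unfolding K_def by (rule image_eqI[of _ _ 0]) auto
    show "x + y \<in> K" if xy: "x \<in> K" "y \<in> K" for x y
    proof -
      obtain p q where "x = evr p" "y = evr q" using xy by (auto simp: K_def)
      then have "x + y = evr (p + q)" by (simp add: hom_distribs)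
      then show ?thesis by (auto simp: K_def)
    qed
    show "of_rat q * x \<in> K" if "x \<in> K" for q x
    proof -
      obtain p where "x = evr p" using \<open>x \<in> K\<close> by (auto simp: K_def)
      then have "of_rat q * x = evr (Polynomial.smult q p)" by (simp add: hom_distribs)
      then show ?thesis by (auto simp: K_def)
    qed
  qed
  then show "rat_vs.span ((\<lambda>j. \<zeta> ^ j) ` {..<n}) \<subseteq> K"
    by (intro rat_vs.span_minimal) (auto simp: zeta_power_in_K)
qed

lemma number_field_K: "number_field K"
  unfolding number_field_def
proof (intro conjI ballI)
  show "1 \<in> K" unfolding K_def by (rule image_eqI[of _ _ 1]) auto
  show "\<exists>B. finite B \<and> K = rat_vs.span B" using K_eq_span by blast
next
  fix x y assume "x \<in> K" "y \<in> K"
  then obtain p q where "x = evr p" "y = evr q" by (auto simp: K_def)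
  then have "x - y = evr (p - q)" "x * y = evr (p * q)" by (simp_all add: hom_distribs)
  then show "x - y \<in> K" "x * y \<in> K" by (auto simp: K_def)
next
  fix x assume x: "x \<in> K"
  show "inverse x \<in> K"
  proof (cases "x = 0")
    case False
    obtain c where "x = (\<Sum>j<n. of_rat (c j) * \<zeta> ^ j)" using K_repr[OF x] by blast
    then obtain p where p: "x = evr p" "degree p < n" unfolding power_sum_eq_evr using degree_power_sum by blast
    then have "p \<noteq> 0" using False by auto
    then obtain q where "evr q * evr p = 1" using evr_inverse p by blast
    then have "inverse x = evr q" by (simp add: p(1) inverse_unique mult.commute)
    then show ?thesis by (auto simp: K_def)
  qed (use x in auto)
qed

lemma nf_degree_K: "nf_degree K = n"
proof -
  have "rat_vs.independent ((\<lambda>j. \<zeta> ^ j) ` {..<n})"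
  proof
    assume "rat_vs.dependent ((\<lambda>j. \<zeta> ^ j) ` {..<n})"
    then obtain u where u: "(\<Sum>v\<in>(\<lambda>j. \<zeta> ^ j) ` {..<n}. of_rat (u v) * v) = 0"
      and nz: "\<exists>v\<in>(\<lambda>j. \<zeta> ^ j) ` {..<n}. u v \<noteq> 0"
      using rat_vs.dependent_finite[of "(\<lambda>j. \<zeta> ^ j) ` {..<n}"] by auto
    from u have "(\<Sum>j<n. of_rat (u (\<zeta> ^ j)) * \<zeta> ^ j) = 0"
      by (subst (asm) sum.reindex[OF inj_power_basis]) simp
    then show False using power_basis_independent[of "\<lambda>j. u (\<zeta> ^ j)"] nz by auto
  qed
  then have "rat_vs.dim K = card ((\<lambda>j. \<zeta> ^ j) ` {..<n})"
    unfolding K_eq_span by (rule rat_vs.dim_span_eq_card_independent)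
  then show ?thesis by (simp add: nf_degree_def card_image[OF inj_power_basis])
qed

end

subsection \<open>Voronoi cells\<close>

text \<open>The quotient map is a group homomorphism. Writing the difference as a single coset lets
  its norm be computed from one representative.\<close>

lemma real_tensor_diff:
  assumes K: "number_field K" and f: "f \<in> carrier (formal_sums K)" and a: "a \<in> K"
  shows "(relation_subgroup K #>\<^bsub>formal_sums K\<^esub> f) \<otimes>\<^bsub>real_tensor K\<^esub>
      inv\<^bsub>real_tensor K\<^esub> pure_tensor K r a
    = relation_subgroup K #>\<^bsub>formal_sums K\<^esub> (f - frag_of (r, a))"
proof -
  interpret G: comm_group "formal_sums K" by (rule abelian_free_Abelian_group)
  have "subgroup (relation_subgroup K) (formal_sums K)"
    unfolding relation_subgroup_def by (rule G.generate_is_subgroup[OF bilinear_relations_closed[OF K]])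
  then interpret N: normal "relation_subgroup K" "formal_sums K"
    by (rule G.subgroup_imp_normal)
  interpret h: group_hom "formal_sums K" "real_tensor K" "\<lambda>x. relation_subgroup K #>\<^bsub>formal_sums K\<^esub> x"
    unfolding real_tensor_def group_hom_def group_hom_axioms_def
    using N.factorgroup_is_group N.r_coset_hom_Mod G.is_group by auto
  have g: "frag_of (r, a) \<in> carrier (formal_sums K)" using a by simp
  have "inv\<^bsub>formal_sums K\<^esub> frag_of (r, a) = - frag_of (r, a)" using a by simp
  then show ?thesis
    unfolding pure_tensor_def using f g
    by (metis h.hom_inv h.hom_mult G.inv_closed mult_free_Abelian_group uminus_add_conv_diff add.commute)
qed

lemma linf_norm_coset_le:
  assumes "number_field K" "finite (embeddings K)" "embeddings K \<noteq> {}"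
    and "\<And>\<sigma>. \<sigma> \<in> embeddings K \<Longrightarrow> cmod (eval_formal \<sigma> f) \<le> t"
  shows "linf_norm K (relation_subgroup K #>\<^bsub>formal_sums K\<^esub> f) \<le> t"
  using assms by (auto simp: linf_norm_def induced_hom_coset)

section \<open>Embeddings of the cyclotomic field\<close>

context two_power_cyclotomic
begin

lemma embedding_power_sum:
  assumes \<sigma>: "\<sigma> \<in> embeddings K"
  shows "\<sigma> (\<Sum>j<m. of_rat (c j) * \<zeta> ^ j) = (\<Sum>j<m. of_rat (c j) * \<sigma> \<zeta> ^ j)"
proof -
  have add: "\<sigma> (x + y) = \<sigma> x + \<sigma> y" and mult: "\<sigma> (x * y) = \<sigma> x * \<sigma> y" if "x \<in> K" "y \<in> K" for x y
    using \<sigma> that by (auto simp: embeddings_def)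
  note cl = number_field_closed[OF number_field_K zeta_power_in_K]
  have one: "\<sigma> 1 = 1" using \<sigma> by (simp add: embeddings_def)
  have pow: "\<sigma> (\<zeta> ^ j) = \<sigma> \<zeta> ^ j" for j
    using mult[OF zeta_power_in_K[of 1] zeta_power_in_K] by (induction j) (auto simp: one)
  \<comment> \<open>Membership in \<open>K\<close> is carried along because \<open>\<sigma>\<close>
    is additive only there.\<close>
  have "(\<Sum>j<m. of_rat (c j) * \<zeta> ^ j) \<in> K \<and>
      \<sigma> (\<Sum>j<m. of_rat (c j) * \<zeta> ^ j) = (\<Sum>j<m. of_rat (c j) * \<sigma> \<zeta> ^ j)"
  proof (induction m)
    case 0
    show ?case using cl(1) embedding_of_rat[OF number_field_K \<sigma>, of 0] by simp
  next
    case (Suc m)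
    then show ?case
      using number_field_closed(3)[OF number_field_K _ cl(5)]
      by (simp add: add[OF _ cl(5)] mult[OF cl(4) zeta_power_in_K] embedding_of_rat[OF number_field_K \<sigma>] pow)
  qed
  then show ?thesis by blast
qed

lemma embedding_zeta_power:
  assumes "\<sigma> \<in> embeddings K"
  shows "\<sigma> \<zeta> ^ n = - 1"
proof -
  \<comment> \<open>The range includes degree \<open>n\<close>, one beyond the basis, to express
    \<open>\<zeta> ^ n\<close> itself as a power sum.\<close>
  have "(\<Sum>j<Suc n. of_rat (if j = n then 1 else 0) * x ^ j) = x ^ n" for x :: complex
    by (simp add: sum.neutral)
  with embedding_power_sum[OF assms, where m = "Suc n" and c = "\<lambda>j. if j = n then 1 else 0"]
  have "\<sigma> \<zeta> ^ n = \<sigma> (\<zeta> ^ n)" by metis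
  also have "\<dots> = - 1"
    using embedding_of_rat[OF number_field_K assms, of "- 1"] by (simp add: zeta)
  finally show ?thesis .
qed

text \<open>The value at \<open>\<zeta>\<close> fixes an embedding on \<open>K\<close>, and
  extensionality fixes it elsewhere. Finiteness of the set of embeddings will follow from that of
  the roots.\<close>

lemma inj_on_embeddings: "inj_on (\<lambda>\<sigma>. \<sigma> \<zeta>) (embeddings K)"
proof (rule inj_onI)
  fix \<sigma> \<tau> assume \<sigma>: "\<sigma> \<in> embeddings K" and \<tau>: "\<tau> \<in> embeddings K" and eq: "\<sigma> \<zeta> = \<tau> \<zeta>"
  show "\<sigma> = \<tau>"
  proof (rule extensionalityI)
    show "\<sigma> \<in> extensional K" "\<tau> \<in> extensional K" using \<sigma> \<tau> by (auto simp: embeddings_def)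
    fix x assume "x \<in> K"
    then obtain c where x: "x = (\<Sum>j<n. of_rat (c j) * \<zeta> ^ j)" using K_repr by blast
    show "\<sigma> x = \<tau> x" unfolding x embedding_power_sum[OF \<sigma>] embedding_power_sum[OF \<tau>] eq ..
  qed
qed

lemma finite_roots: "finite {\<omega> :: complex. \<omega> ^ n = - 1}"
  and card_roots: "card {\<omega> :: complex. \<omega> ^ n = - 1} = n"
proof -
  show "card {\<omega> :: complex. \<omega> ^ n = - 1} = n" using n_pos by (intro card_nth_roots) auto
  then show "finite {\<omega> :: complex. \<omega> ^ n = - 1}" using n_pos card_ge_0_finite by metis
qed

lemma finite_embeddings: "finite (embeddings K)"
proof (rule finite_imageD[OF _ inj_on_embeddings])
  show "finite ((\<lambda>\<sigma>. \<sigma> \<zeta>) ` embeddings K)"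
    by (rule finite_subset[OF _ finite_roots]) (auto simp: embedding_zeta_power)
qed

lemma embeddings_nonempty: "embeddings K \<noteq> {}"
proof -
  have "restrict (\<lambda>x. x) K \<in> embeddings K"
    using number_field_K number_field_closed[OF number_field_K] by (auto simp: embeddings_def number_field_def)
  then show ?thesis by blast
qed

section \<open>Real coordinates and the Voronoi radius\<close>

lemma eval_formal_real_coordinates:
  assumes f: "f \<in> carrier (formal_sums K)"
  shows "\<exists>c :: nat \<Rightarrow> real. \<forall>\<sigma>\<in>embeddings K. eval_formal \<sigma> f = (\<Sum>j<n. of_real (c j) * \<sigma> \<zeta> ^ j)"
proof -
  obtain q where q: "\<And>a. a \<in> K \<Longrightarrow> a = (\<Sum>j<n. of_rat (q a j) * \<zeta> ^ j)"
    using K_repr by metis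
  \<comment> \<open>Expanding the \<open>K\<close> component of every formal term in the power basis
    gives coordinates independent of \<open>\<sigma>\<close>, so one rounding serves all
    embeddings.\<close>
  define c :: "nat \<Rightarrow> real" where
    "c j = (\<Sum>p\<in>Poly_Mapping.keys f. of_int (Poly_Mapping.lookup f p) * (fst p * of_rat (q (snd p) j)))" for j
  have rc: "complex_of_real (of_rat x) = of_rat x" for x
    by (cases x) (simp add: of_rat_rat)
  have "eval_formal \<sigma> f = (\<Sum>j<n. of_real (c j) * \<sigma> \<zeta> ^ j)" if \<sigma>: "\<sigma> \<in> embeddings K" for \<sigma>
  proof -
    have "\<sigma> a = (\<Sum>j<n. of_rat (q a j) * \<sigma> \<zeta> ^ j)" if "a \<in> K" for a
      using embedding_power_sum[OF \<sigma>] q[OF that] by metis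
    moreover have "snd p \<in> K" if "p \<in> Poly_Mapping.keys f" for p
      using f that by auto
    ultimately have "eval_formal \<sigma> f = (\<Sum>p\<in>Poly_Mapping.keys f. \<Sum>j<n.
        of_int (Poly_Mapping.lookup f p) * (of_real (fst p) * (of_rat (q (snd p) j) * \<sigma> \<zeta> ^ j)))"
      unfolding eval_formal_def case_prod_unfold
      by (intro sum.cong) (auto simp: sum_distrib_left)
    also have "\<dots> = (\<Sum>j<n. of_real (c j) * \<sigma> \<zeta> ^ j)"
      by (subst sum.swap) (simp add: c_def rc sum_distrib_right mult.assoc)
    finally show ?thesis .
  qed
  then show ?thesis by blast
qed

lemma integer_power_sum_in_ring_of_integers:
  "(\<Sum>j<n. of_int (u j) * \<zeta> ^ j) \<in> ring_of_integers K"
proof -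
  have "(\<Sum>j<n. of_int (u j) * \<zeta> ^ j) = evi (\<Sum>j<n. monom (u j) j)"
    by (simp add: hom_distribs poly_sum poly_monom)
  moreover have "(\<Sum>j<n. of_int (u j) * \<zeta> ^ j) = evr (\<Sum>j<n. monom (of_int (u j)) j)"
    using power_sum_eq_evr[of "\<lambda>j. of_int (u j)"] by simp
  ultimately show ?thesis
    using algebraic_int_evi unfolding ring_of_integers_def K_def by (metis (mono_tags, lifting) mem_Collect_eq rangeI)
qed

text \<open>A point of the cell is no farther from 0 than from any algebraic integer. Testing this
  against the integer \<open>a\<close> obtained by rounding its coordinates bounds its norm.\<close>

lemma linf_voronoi_radius_le:
  "linf_voronoi_radius K \<le> ereal (2 * sqrt n * (ln (4 * n) + 1))"
  unfolding linf_voronoi_radius_def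
proof (rule SUP_least)
  fix X assume X: "X \<in> linf_voronoi_cell K"
  then obtain f where f: "f \<in> carrier (formal_sums K)"
    and Xf: "X = relation_subgroup K #>\<^bsub>formal_sums K\<^esub> f"
    by (auto simp: linf_voronoi_cell_def real_tensor_def carrier_FactGroup)
  obtain c :: "nat \<Rightarrow> real" where
    c: "\<And>\<sigma>. \<sigma> \<in> embeddings K \<Longrightarrow> eval_formal \<sigma> f = (\<Sum>j<n. of_real (c j) * \<sigma> \<zeta> ^ j)"
    using eval_formal_real_coordinates[OF f] by blast
  have unit: "cmod \<omega> = 1" if "\<omega> ^ n = - 1" for \<omega>
  proof -
    have "cmod \<omega> ^ n = 1" using that by (metis norm_minus_cancel norm_one norm_power)
    then show ?thesis using n_pos power_eq_imp_eq_base[of "cmod \<omega>" n 1] by simp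
  qed
  obtain u :: "nat \<Rightarrow> int" where
    u: "\<And>\<omega>. \<omega> ^ n = - 1 \<Longrightarrow> cmod (\<Sum>j<n. (of_real (c j) - of_int (u j)) * \<omega> ^ j) \<le> 2 * sqrt n * (ln (4 * n) + 1)"
    using integer_rounding_on_unit_circle[of "{\<omega>. \<omega> ^ n = - 1}" n n c]
      finite_roots card_roots n_pos unit by auto
  define a where "a = (\<Sum>j<n. of_int (u j) * \<zeta> ^ j)"
  have aO: "a \<in> ring_of_integers K" unfolding a_def by (rule integer_power_sum_in_ring_of_integers)
  then have aK: "a \<in> K" by (simp add: ring_of_integers_def)
  have "cmod (eval_formal \<sigma> (f - frag_of (1, a))) \<le> 2 * sqrt n * (ln (4 * n) + 1)"
    if \<sigma>: "\<sigma> \<in> embeddings K" for \<sigma>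
  proof -
    have "\<sigma> a = (\<Sum>j<n. of_int (u j) * \<sigma> \<zeta> ^ j)"
      using embedding_power_sum[OF \<sigma>, where c = "\<lambda>j. of_int (u j)"] by (simp add: a_def)
    then have "eval_formal \<sigma> (f - frag_of (1, a)) = (\<Sum>j<n. (of_real (c j) - of_int (u j)) * \<sigma> \<zeta> ^ j)"
      by (simp add: eval_formal_diff eval_formal_frag_of c[OF \<sigma>] left_diff_distrib sum_subtractf)
    then show ?thesis using u[OF embedding_zeta_power[OF \<sigma>]] by simp
  qed
  then have "linf_norm K (relation_subgroup K #>\<^bsub>formal_sums K\<^esub> (f - frag_of (1, a)))
      \<le> 2 * sqrt n * (ln (4 * n) + 1)"
    by (intro linf_norm_coset_le number_field_K finite_embeddings embeddings_nonempty)
  moreover have "linf_norm K X \<le> linf_norm K (X \<otimes>\<^bsub>real_tensor K\<^esub> inv\<^bsub>real_tensor K\<^esub> pure_tensor K 1 a)"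
    using X aO by (auto simp: linf_voronoi_cell_def)
  ultimately show "ereal (linf_norm K X) \<le> ereal (2 * sqrt n * (ln (4 * n) + 1))"
    by (simp add: Xf real_tensor_diff[OF number_field_K f aK])
qed

end

section \<open>Fields of arbitrarily large degree and the exponent bound\<close>

lemma two_power_cyclotomic_cis: "two_power_cyclotomic k (2 ^ k) (cis (pi / 2 ^ k))"
  by unfold_locales (auto simp: DeMoivre)

theorem theorem1p4:
  shows "0 \<le> nu_infinity \<and> nu_infinity \<le> ereal (ln (3/2) / ln 2) \<and>
         0.5849 \<le> ln (3/2) / ln (2::real) \<and> ln (3/2) / ln (2::real) < 0.5850"
proof (intro conjI log2_three_halves_bounds)
  show "0 \<le> nu_infinity"
    unfolding nu_infinity_def by (rule Inf_greatest) auto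
  have "\<exists>K. number_field K \<and> nf_degree K \<ge> D \<and>
      linf_voronoi_radius K \<le> ereal (real (nf_degree K) powr (58 / 100))" for D
  proof -
    from eventually_rounding_bound obtain M :: nat where
      "\<forall>n\<ge>M. 2 * sqrt (real n) * (ln (4 * real n) + 1) \<le> real n powr (58 / 100)"
      unfolding eventually_at_top_linorder ..
    then have M: "2 * sqrt (real n) * (ln (4 * real n) + 1) \<le> real n powr (58 / 100)" if "n \<ge> M" for n
      using that by blast
    \<comment> \<open>The degree \<open>2 ^ k\<close> then exceeds both the asymptotic threshold
      \<open>M\<close> and the required degree \<open>D\<close>.\<close>
    define k where "k = M + D"
    interpret two_power_cyclotomic k "2 ^ k" "cis (pi / 2 ^ k)" by (rule two_power_cyclotomic_cis)
    have "k < 2 ^ k" by (rule less_exp)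
    moreover have "M \<le> k" "D \<le> k" by (simp_all add: k_def)
    ultimately have "M \<le> 2 ^ k" "D \<le> 2 ^ k" by linarith+
    then show ?thesis
      using number_field_K nf_degree_K order_trans[OF linf_voronoi_radius_le] M[of "2 ^ k"]
      by (intro exI[of _ K]) auto
  qed
  then have "nu_infinity \<le> ereal (58 / 100)"
    unfolding nu_infinity_def by (intro Inf_lower CollectI exI[of _ "58 / 100"]) auto
  also have "\<dots> \<le> ereal (ln (3/2) / ln 2)"
    using order_trans[OF _ log2_three_halves_bounds(1), of "58 / 100"] by simp
  finally show "nu_infinity \<le> ereal (ln (3/2) / ln 2)" .
qed

end
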